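(* For every $1\le q<2$, $\lim_{d\to\infty}\mathfrak{p}_d(q)\le0$.
   Context: $\mathbb{T}^d$ is the $d$-fold torus with normalized Haar measure. $H^p(\mathbb{T}^d)$ denotes the Hardy space (for $p\ge1$: functions in $L^p(\mathbb{T}^d)$ with Fourier coefficients supported in $\mathbb{N}_0^d$; for $0<p<1$ the usual Hardy space on the polydisc). The Riesz projection is $P_+\psi=\sum_{\alpha\in\mathbb{N}_0^d}\widehat\psi(\alpha)z^\alpha$. For nontrivial $\varphi$ in some $H^p(\mathbb{T}^d)$, $\|\varphi\|_0:=\exp\left(\int_{\mathbb{T}^d}\log|\varphi|\right)$. For $1\le q\le\infty$, $\mathfrak{p}_d(q):=\sup\{p\ge0: \|P_+\psi\|_p\le\|\psi\|_q \text{ for every }\psi\in L^q(\mathbb{T}^d)\}$ if this set is nonempty, and $\mathfrak{p}_d(q):=-1$ otherwise. (For fixed $q$, $d\mapsto\mathfrak{p}_d(q)$ is nonincreasing, so the limit exists in $[-1,\infty)$.) *)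

theory Defs
  imports "HOL-Analysis.Analysis"
begin

definition circle_measure :: "complex measure" where
  "circle_measure = distr (uniform_measure lborel {0..1::real}) borel (\<lambda>t. cis (2 * pi * t))"

text \<open>Points of T^d are extensional functions z :: nat => complex on {..<d}.\<close>
definition torus :: "nat \<Rightarrow> (nat \<Rightarrow> complex) measure" where
  "torus d = (\<Pi>\<^sub>M j\<in>{..<d}. circle_measure)"

definition in_Lq :: "nat \<Rightarrow> real \<Rightarrow> ((nat \<Rightarrow> complex) \<Rightarrow> complex) \<Rightarrow> bool" where
  "in_Lq d q \<psi> \<longleftrightarrow> \<psi> \<in> borel_measurable (torus d) \<and>
      integrable (torus d) (\<lambda>z. norm (\<psi> z) powr q)"

definition Lq_norm :: "nat \<Rightarrow> real \<Rightarrow> ((nat \<Rightarrow> complex) \<Rightarrow> complex) \<Rightarrow> real" where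
  "Lq_norm d q \<psi> = (\<integral>z. norm (\<psi> z) powr q \<partial>torus d) powr (1 / q)"

definition fourier_coeff :: "nat \<Rightarrow> ((nat \<Rightarrow> complex) \<Rightarrow> complex) \<Rightarrow> (nat \<Rightarrow> int) \<Rightarrow> complex" where
  "fourier_coeff d \<psi> \<alpha> = (\<integral>z. \<psi> z * (\<Prod>j<d. z j powi (- \<alpha> j)) \<partial>torus d)"

definition multi_idx :: "nat \<Rightarrow> (nat \<Rightarrow> nat) set" where
  "multi_idx d = {\<alpha>. \<forall>j\<ge>d. \<alpha> j = 0}"

text \<open>The Riesz projection P_+ psi, realised (as usual for Hardy spaces on the
  polydisc) as the holomorphic function on the open polydisc
  w |-> sum over alpha in N_0^d of hat psi(alpha) w^alpha.\<close>
definition riesz_proj :: "nat \<Rightarrow> ((nat \<Rightarrow> complex) \<Rightarrow> complex) \<Rightarrow> (nat \<Rightarrow> complex) \<Rightarrow> complex" where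
  "riesz_proj d \<psi> w =
     (\<Sum>\<^sub>\<infinity>\<alpha>\<in>multi_idx d. fourier_coeff d \<psi> (\<lambda>j. int (\<alpha> j)) * (\<Prod>j<d. w j ^ \<alpha> j))"

text \<open>For 0 < p: ||F||_p = sup_{0<r<1} (integral over T^d of |F(r z)|^p)^(1/p)
  (value infinity iff F is not in H^p).\<close>
definition Hp_radial_norm :: "nat \<Rightarrow> real \<Rightarrow> ((nat \<Rightarrow> complex) \<Rightarrow> complex) \<Rightarrow> ereal" where
  "Hp_radial_norm d p F =
     (SUP r\<in>{0<..<1::real}. ereal ((\<integral>z. norm (F (\<lambda>j. complex_of_real r * z j)) powr p \<partial>torus d) powr (1 / p)))"

definition boundary_fun :: "((nat \<Rightarrow> complex) \<Rightarrow> complex) \<Rightarrow> (nat \<Rightarrow> complex) \<Rightarrow> complex" where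
  "boundary_fun F z = Lim (at_left (1::real)) (\<lambda>r. F (\<lambda>j. complex_of_real r * z j))"

text \<open>||phi||_0 = exp (integral of log |phi|) for phi in some H^s (s > 0), with
  the conventions exp(-infinity) = 0 (also used for the trivial phi); if F lies in
  no H^s the quantity is taken to be infinity.\<close>
definition H0_norm :: "nat \<Rightarrow> ((nat \<Rightarrow> complex) \<Rightarrow> complex) \<Rightarrow> ereal" where
  "H0_norm d F =
     (if \<exists>s>0. Hp_radial_norm d s F < \<infinity> then
        (if (AE z in torus d. boundary_fun F z \<noteq> 0) \<and>
            integrable (torus d) (\<lambda>z. ln (norm (boundary_fun F z)))
         then ereal (exp (\<integral>z. ln (norm (boundary_fun F z)) \<partial>torus d))
         else 0)
      else \<infinity>)"

definition H_norm :: "nat \<Rightarrow> real \<Rightarrow> ((nat \<Rightarrow> complex) \<Rightarrow> complex) \<Rightarrow> ereal" where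
  "H_norm d p F = (if p = 0 then H0_norm d F else Hp_radial_norm d p F)"

definition good_exps :: "nat \<Rightarrow> real \<Rightarrow> real set" where
  "good_exps d q = {p. p \<ge> 0 \<and>
     (\<forall>\<psi>. in_Lq d q \<psi> \<longrightarrow> H_norm d p (riesz_proj d \<psi>) \<le> ereal (Lq_norm d q \<psi>))}"

definition crit_exp :: "nat \<Rightarrow> real \<Rightarrow> ereal" where
  "crit_exp d q = (if good_exps d q = {} then -1 else Sup (ereal ` good_exps d q))"

end

theory Submission
  imports Defs "HOL-Probability.Infinite_Product_Measure"
begin

text \<open>
  The vertices of the cube are in convex position. For any set \<open>S\<close> of vertices of \<open>{0,1}\<^sup>k\<close>,
  each vertex \<open>t \<notin> S\<close> is cut off from all other vertices by the half-space
  \<open>dist(n, t) - 1 \<ge> 0\<close>, where the Hamming distance \<open>dist(n, t)\<close> is affine in \<open>n\<close>. Using one extra variable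
  \<open>w\<^sub>t\<close> with exponent \<open>dist(n, t) - 1\<close> for each such constraint, the Riesz projection turns a
  twisted copy of \<open>\<Prod>i<k. (1 + z\<^sub>i)\<close> into the partial sum of its monomials over \<open>n \<in> S\<close>.

  Khinchine's inequality, averaged over all \<open>S\<close>, gives a choice of \<open>S\<close> for which the partial sum has
  \<open>p\<close>-norm at least \<open>c\<^sub>p 2\<^bsup>k/2\<^esup>\<close>, for any \<open>p > 0\<close>. The full product has \<open>q\<close>-norm
  \<open>\<parallel>1 + z\<parallel>\<^sub>q\<^sup>k\<close>, and \<open>\<parallel>1 + z\<parallel>\<^sub>q < \<parallel>1 + z\<parallel>\<^sub>2 = sqrt 2\<close> since \<open>q < 2\<close>. So contractivity fails
  once \<open>k\<close> is large.
\<close>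

subsection \<open>Trigonometric polynomials on the torus\<close>

lemma sets_circle_measure [measurable_cong, simp]: "sets circle_measure = sets borel"
  by (simp add: circle_measure_def)

lemma uniform_unit_interval_eq:
  "uniform_measure lborel {0..1::real} = density lborel (\<lambda>x. ennreal (indicator {0..1} x))"
  unfolding uniform_measure_def by (intro density_cong) (auto simp: indicator_def)

lemma cis_measurable [measurable]: "(\<lambda>t. cis (2 * pi * t)) \<in> borel_measurable borel"
  by (intro borel_measurable_continuous_onI continuous_intros)

lemma cis_measurable_uniform [measurable]:
  "(\<lambda>t. cis (2 * pi * t)) \<in> borel_measurable (uniform_measure lborel {0..1::real})"
proof -
  have "continuous_on UNIV (\<lambda>t. cis (2 * pi * t))" by (intro continuous_intros)
  from borel_measurable_continuous_onI[OF this] show ?thesis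
    by (rule measurable_cong_sets[THEN equalityD1, THEN subsetD, rotated 2]) auto
qed

lemma prob_space_circle_measure: "prob_space circle_measure"
  unfolding circle_measure_def
  by (intro prob_space.prob_space_distr prob_space_uniform_measure) auto

lemma AE_circle_measure: "AE z in circle_measure. norm z = 1"
  unfolding circle_measure_def by (subst AE_distr_iff) auto

lemma circle_integral_powi:
  "integrable circle_measure (\<lambda>z. z powi m)"
  "(\<integral>z. z powi m \<partial>circle_measure) = of_bool (m = 0)"
proof -
  interpret prob_space circle_measure by (rule prob_space_circle_measure)
  have meas [measurable]: "(\<lambda>z::complex. z powi m) \<in> borel_measurable borel"
    unfolding power_int_def by measurable
  show "integrable circle_measure (\<lambda>z. z powi m)"
    by (rule integrable_const_bound[where B = 1])
       (use AE_circle_measure in eventually_elim, auto simp: norm_power_int)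
  have "(\<integral>z. z powi m \<partial>circle_measure)
      = (\<integral>t. cis (2 * pi * t) powi m \<partial>uniform_measure lborel {0..1::real})"
    unfolding circle_measure_def by (rule integral_distr) auto
  also have "\<dots> = (\<integral>t. indicator {0..1} t *\<^sub>R (cis (2 * pi * t) powi m) \<partial>lborel)"
    unfolding uniform_unit_interval_eq
    by (rule integral_density) (use cis_measurable in measurable)
  also have "\<dots> = (\<integral>t. indicator {0..1} t *\<^sub>R cis (2 * pi * m * t) \<partial>lborel)"
    by (simp add: cis_power_int mult_ac)
  also have "\<dots> = of_bool (m = 0)"
  proof (cases "m = 0")
    case False
    define F where "F = (\<lambda>t. cis (2 * pi * m * t) / (\<i> * (2 * pi * m)))"
    have "(\<integral>t. indicator {0..1} t *\<^sub>R cis (2 * pi * m * t) \<partial>lborel) = F 1 - F 0"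
    proof (rule integral_FTC_Icc)
      fix t :: real
      have "((\<lambda>z. exp (\<i> * (2 * pi * m) * z) / (\<i> * (2 * pi * m)))
              has_field_derivative exp (\<i> * (2 * pi * m) * of_real t)) (at (of_real t))"
        using False by (auto intro!: derivative_eq_intros)
      from has_vector_derivative_real_field[OF this]
      show "(F has_vector_derivative cis (2 * pi * m * t)) (at t within {0..1})"
        by (simp add: F_def cis_conv_exp mult_ac)
    qed (auto intro!: continuous_intros)
    also have "cis (2 * pi * m) = 1"
      by (simp add: cis_multiple_2pi)
    hence "F 1 - F 0 = 0"
      by (simp add: F_def)
    finally show ?thesis using False by simp
  qed simp
  finally show "(\<integral>z. z powi m \<partial>circle_measure) = of_bool (m = 0)" .
qed

interpretation circle: product_prob_space "\<lambda>_::nat. circle_measure" UNIV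
  by (intro product_prob_spaceI prob_space_circle_measure)

lemma prob_space_torus: "prob_space (torus d)"
  unfolding torus_def by (intro prob_space_PiM prob_space_circle_measure)

lemma AE_torus: "AE z in torus d. \<forall>j<d. norm (z j) = 1"
proof -
  have "AE z in torus d. \<forall>j\<in>{..<d}. norm (z j) = 1"
    unfolding torus_def
    by (intro AE_finite_allI AE_PiM_component prob_space_circle_measure AE_circle_measure) auto
  thus ?thesis by (rule AE_mp) (auto intro: AE_I2)
qed

lemma torus_component_measurable [measurable]:
  assumes "j < d"
  shows "(\<lambda>z. z j) \<in> borel_measurable (torus d)"
proof -
  have "(\<lambda>z. z j) \<in> measurable (torus d) circle_measure"
    unfolding torus_def using assms by (intro measurable_component_singleton) auto
  thus ?thesis
    by (rule measurable_cong_sets[THEN equalityD1, THEN subsetD, rotated 2]) auto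
qed

lemma torus_monomial_measurable [measurable]:
  "(\<lambda>z. \<Prod>j<d. z j powi L j) \<in> borel_measurable (torus d)"
  unfolding power_int_def by (intro borel_measurable_prod) (auto intro!: measurable_If)

lemma torus_integral_monomial:
  "integrable (torus d) (\<lambda>z. \<Prod>j<d. z j powi L j)"
  "(\<integral>z. (\<Prod>j<d. z j powi L j) \<partial>torus d) = of_bool (\<forall>j<d. L j = 0)"
proof -
  show "integrable (torus d) (\<lambda>z. \<Prod>j<d. z j powi L j)"
    unfolding torus_def by (intro circle.product_integrable_prod circle_integral_powi) auto
  have "(\<integral>z. (\<Prod>j<d. z j powi L j) \<partial>torus d) = (\<Prod>j<d. of_bool (L j = 0))"
    unfolding torus_def
    by (subst circle.product_integral_prod) (auto intro!: circle_integral_powi simp: circle_integral_powi(2))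
  also have "\<dots> = of_bool (\<forall>j<d. L j = 0)"
    by (induction d) (auto simp: less_Suc_eq)
  finally show "(\<integral>z. (\<Prod>j<d. z j powi L j) \<partial>torus d) = of_bool (\<forall>j<d. L j = 0)" .
qed

text \<open>Orthogonality of characters. The count allows for repeated frequencies; injectivity is
  imposed only when the projection is formed.\<close>

lemma fourier_coeff_trig_poly:
  assumes "finite X"
  shows "fourier_coeff d (\<lambda>z. \<Sum>x\<in>X. \<Prod>j<d. z j powi L x j) \<alpha>
       = of_nat (card {x\<in>X. \<forall>j<d. L x j = \<alpha> j})"
proof -
  have "fourier_coeff d (\<lambda>z. \<Sum>x\<in>X. \<Prod>j<d. z j powi L x j) \<alpha>
      = (\<integral>z. (\<Sum>x\<in>X. \<Prod>j<d. z j powi (L x j - \<alpha> j)) \<partial>torus d)"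
    unfolding fourier_coeff_def
  proof (rule integral_cong_AE)
    show "(\<lambda>z. (\<Sum>x\<in>X. \<Prod>j<d. z j powi L x j) * (\<Prod>j<d. z j powi - \<alpha> j)) \<in> borel_measurable (torus d)"
      by (intro borel_measurable_times borel_measurable_sum torus_monomial_measurable)
    show "AE z in torus d. (\<Sum>x\<in>X. \<Prod>j<d. z j powi L x j) * (\<Prod>j<d. z j powi - \<alpha> j) =
        (\<Sum>x\<in>X. \<Prod>j<d. z j powi (L x j - \<alpha> j))"
      \<comment> \<open>The law of exponents for \<open>powi\<close> is applied at nonzero
        \<open>z j\<close>, which holds almost everywhere.\<close>
      using AE_torus[of d]
    proof eventually_elim
      case (elim z)
      hence "z j \<noteq> 0" if "j < d" for j using that by force
      thus ?case
        by (auto simp: sum_distrib_right prod.distrib[symmetric] power_int_add[symmetric] intro!: sum.cong prod.cong)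
    qed
  qed (intro borel_measurable_sum torus_monomial_measurable)
  also have "\<dots> = (\<Sum>x\<in>X. of_bool (\<forall>j<d. L x j - \<alpha> j = 0))"
    by (subst Bochner_Integration.integral_sum)
       (simp_all add: torus_integral_monomial)
  also have "\<dots> = of_nat (card {x\<in>X. \<forall>j<d. L x j = \<alpha> j})"
    using assms by (simp add: of_bool_def sum.If_cases Int_def)
  finally show ?thesis .
qed

text \<open>Distinct frequencies make each surviving coefficient equal to 1, and the infinite sum
  collapses to the finitely many frequencies in the positive orthant. The identity holds at every
  \<open>w\<close>, so it serves both the radial dilates and the torus itself.\<close>

lemma riesz_proj_trig_poly:
  assumes "finite X" and inj: "\<And>x y. x \<in> X \<Longrightarrow> y \<in> X \<Longrightarrow> \<forall>j<d. L x j = L y j \<Longrightarrow> x = y"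
  shows "riesz_proj d (\<lambda>z. \<Sum>x\<in>X. \<Prod>j<d. z j powi L x j) w
       = (\<Sum>x\<in>{x\<in>X. \<forall>j<d. 0 \<le> L x j}. \<Prod>j<d. w j ^ nat (L x j))"
proof -
  define Y where "Y = {x\<in>X. \<forall>j<d. 0 \<le> L x j}"
  \<comment> \<open>Padding with zeros from \<open>d\<close> on makes \<open>f x\<close> an element
    of \<open>multi_idx d\<close>.\<close>
  define f where "f = (\<lambda>x j. if j < d then nat (L x j) else 0)"
  define c where "c = (\<lambda>\<alpha>. of_nat (card {x\<in>X. \<forall>j<d. L x j = int (\<alpha> j)}) :: complex)"
  have finY: "finite Y" using assms by (simp add: Y_def)
  have injf: "inj_on f Y"
  proof (rule inj_onI)
    fix x y assume "x \<in> Y" "y \<in> Y" "f x = f y"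
    hence "nat (L x j) = nat (L y j)" if "j < d" for j
      using that by (metis f_def)
    hence "L x j = L y j" if "j < d" for j
      using that \<open>x \<in> Y\<close> \<open>y \<in> Y\<close> by (simp add: Y_def nat_eq_iff2)
    thus "x = y" using \<open>x \<in> Y\<close> \<open>y \<in> Y\<close> by (intro inj) (auto simp: Y_def)
  qed
  have c1: "c (f x) = 1" if "x \<in> Y" for x
  proof -
    have "{y\<in>X. \<forall>j<d. L y j = int (f x j)} = {x}"
      using that inj by (auto simp: Y_def f_def)
    thus ?thesis by (simp add: c_def)
  qed
  have c0: "c \<alpha> = 0" if "\<alpha> \<in> multi_idx d - f ` Y" for \<alpha>
  proof -
    have False if x: "x \<in> X" "\<forall>j<d. L x j = int (\<alpha> j)" for x
    proof -
      have "x \<in> Y" using x by (auto simp: Y_def)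
      moreover have "f x = \<alpha>" using x \<open>\<alpha> \<in> _\<close> by (auto simp: f_def multi_idx_def fun_eq_iff)
      ultimately show False using \<open>\<alpha> \<in> _\<close> by auto
    qed
    hence "{x\<in>X. \<forall>j<d. L x j = int (\<alpha> j)} = {}" by auto
    thus ?thesis unfolding c_def by (simp only: card.empty of_nat_0)
  qed
  have "riesz_proj d (\<lambda>z. \<Sum>x\<in>X. \<Prod>j<d. z j powi L x j) w
      = (\<Sum>\<^sub>\<infinity>\<alpha>\<in>multi_idx d. c \<alpha> * (\<Prod>j<d. w j ^ \<alpha> j))"
    unfolding riesz_proj_def fourier_coeff_trig_poly[OF assms(1)] c_def ..
  also have "\<dots> = (\<Sum>\<^sub>\<infinity>\<alpha>\<in>f ` Y. c \<alpha> * (\<Prod>j<d. w j ^ \<alpha> j))"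
    by (rule infsum_cong_neutral) (auto simp: c0 f_def multi_idx_def)
  also have "\<dots> = (\<Sum>\<alpha>\<in>f ` Y. c \<alpha> * (\<Prod>j<d. w j ^ \<alpha> j))"
    using finY by simp
  also have "\<dots> = (\<Sum>x\<in>Y. \<Prod>j<d. w j ^ nat (L x j))"
    by (subst sum.reindex[OF injf]) (simp add: c1, simp add: f_def)
  finally show ?thesis by (simp add: Y_def)
qed

subsection \<open>Elementary inequalities and random subset sums\<close>

lemma weighted_arith_geom_powr:
  fixes a b \<theta> :: real
  assumes "0 \<le> a" "0 \<le> b" "0 < \<theta>" "\<theta> < 1"
  shows "a powr \<theta> * b powr (1 - \<theta>) \<le> \<theta> * a + (1 - \<theta>) * b"
proof (cases "a = 0 \<or> b = 0")
  case False
  thus ?thesis using assms by (intro Youngs_inequality_0) auto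
qed (use assms in auto)

text \<open>With the coefficient 1/12, the square of the right side exceeds \<open>1 + x\<close> by
  an explicit nonnegative expression. The quadratic gain is what later pushes the
  \<open>q\<close>-norm strictly below the 2-norm.\<close>

lemma sqrt_one_plus_le:
  fixes x :: real
  assumes "-1 \<le> x" "x \<le> 1"
  shows "sqrt (1 + x) \<le> 1 + x / 2 - x\<^sup>2 / 12"
proof (rule real_le_lsqrt)
  have "x\<^sup>2 \<le> 1" using assms by (simp add: abs_square_le_1 abs_le_iff)
  thus "0 \<le> 1 + x / 2 - x\<^sup>2 / 12" using assms by linarith
  have "(1 + x / 2 - x\<^sup>2 / 12)\<^sup>2 - (1 + x) = x\<^sup>2 * (1 - x) / 12 + (x\<^sup>2)\<^sup>2 / 144"
    by (simp add: power2_eq_square field_simps)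
  also have "\<dots> \<ge> 0" using assms by simp
  finally show "1 + x \<le> (1 + x / 2 - x\<^sup>2 / 12)\<^sup>2" by simp
qed

text \<open>Interpolation between the exponents 1/2 and 1: since
  \<open>s = 1/2 * (2 - 2 * s) + (2 * s - 1)\<close>, weighted AM-GM bounds the power by a convex
  combination of \<open>sqrt (1 + x)\<close> and \<open>1 + x\<close>. The gain is
  \<open>(2 - 2 * s) / 12\<close>.\<close>

lemma one_plus_powr_le:
  fixes x s :: real
  assumes x: "-1 \<le> x" "x \<le> 1" and s: "1/2 \<le> s" "s < 1"
  shows "(1 + x) powr s \<le> 1 + s * x - (1 - s) / 6 * x\<^sup>2"
proof -
  have "(1 + x) powr s \<le> (2 - 2 * s) * sqrt (1 + x) + (2 * s - 1) * (1 + x)"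
  \<comment> \<open>At \<open>s = 1/2\<close> the weight \<open>2 - 2 * s\<close> is 1, outside the
    open range allowed in AM-GM.\<close>
  proof (cases "s = 1/2")
    case True
    show ?thesis unfolding True using x by (simp add: powr_half_sqrt)
  next
    case False
    have "(1 + x) powr s = (1 + x) powr (1/2 * (2 - 2 * s) + (2 * s - 1))"
      by (simp add: field_simps)
    also have "\<dots> = sqrt (1 + x) powr (2 - 2 * s) * (1 + x) powr (1 - (2 - 2 * s))"
      using x by (simp add: powr_add powr_powr powr_half_sqrt[symmetric])
    also have "\<dots> \<le> (2 - 2 * s) * sqrt (1 + x) + (1 - (2 - 2 * s)) * (1 + x)"
      using x s False by (intro weighted_arith_geom_powr) auto
    finally show ?thesis by simp
  qed
  also have "\<dots> \<le> (2 - 2 * s) * (1 + x / 2 - x\<^sup>2 / 12) + (2 * s - 1) * (1 + x)"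
    using sqrt_one_plus_le[OF x] s by (intro add_mono mult_left_mono) auto
  also have "\<dots> = 1 + s * x - (1 - s) / 6 * x\<^sup>2"
    by (simp add: field_simps)
  finally show ?thesis .
qed

text \<open>Uses that the squared norm of \<open>1 + \<zeta>\<close> is
  \<open>2 * (1 + Re \<zeta>)\<close> and that \<open>(Re \<zeta>)\<^sup>2\<close> is
  \<open>(1 + Re (\<zeta>\<^sup>2)) / 2\<close>. The majorant is a trigonometric polynomial, so its
  mean over the circle is just its constant term, after any rotation as well.\<close>

lemma norm_one_plus_powr_le:
  fixes \<zeta> :: complex and q :: real
  assumes "norm \<zeta> = 1" and q: "1 \<le> q" "q < 2"
  shows "norm (1 + \<zeta>) powr q
       \<le> 2 powr (q / 2) * (1 - (2 - q) / 24 + q / 2 * Re \<zeta> - (2 - q) / 24 * Re (\<zeta>\<^sup>2))"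
proof -
  define x where "x = Re \<zeta>"
  have x: "-1 \<le> x" "x \<le> 1"
    using abs_Re_le_cmod[of \<zeta>] assms by (auto simp: x_def abs_le_iff)
  have one: "x\<^sup>2 + (Im \<zeta>)\<^sup>2 = 1"
    using assms(1) cmod_power2[of \<zeta>] by (simp add: x_def)
  have n: "(norm (1 + \<zeta>))\<^sup>2 = 2 * (1 + x)"
    using one unfolding cmod_power2 by (simp add: x_def power2_eq_square algebra_simps)
  have "norm (1 + \<zeta>) powr q = ((norm (1 + \<zeta>)) powr 2) powr (q / 2)"
    by (simp only: powr_powr) simp
  also have "\<dots> = 2 powr (q / 2) * (1 + x) powr (q / 2)"
    using n x powr_mult[of 2 "1 + x" "q / 2"] by simp
  also have "\<dots> \<le> 2 powr (q / 2) * (1 + q / 2 * x - (1 - q / 2) / 6 * x\<^sup>2)"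
    using x q by (intro mult_left_mono one_plus_powr_le) auto
  also have "1 + q / 2 * x - (1 - q / 2) / 6 * x\<^sup>2
           = 1 - (2 - q) / 24 + q / 2 * Re \<zeta> - (2 - q) / 24 * Re (\<zeta>\<^sup>2)"
  proof -
    have x2: "x\<^sup>2 = (1 + Re (\<zeta>\<^sup>2)) / 2" using one by (simp add: x_def power2_eq_square)
    show ?thesis unfolding x2 by (simp add: x_def[symmetric] field_simps)
  qed
  finally show ?thesis .
qed

text \<open>
  Reduces the lower Khinchine bound for exponents \<open>p \<le> 2\<close> to the second and fourth moments.
\<close>

lemma sq_minus_fourth_le_powr:
  fixes y p :: real
  assumes "0 \<le> y" "0 < p" "p \<le> 2"
  shows "y\<^sup>2 - y ^ 4 \<le> y powr p"
proof (cases "y \<le> 1")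
  case True
  have "y powr 2 \<le> y powr p" if "y \<noteq> 0"
    using assms True that by (intro powr_mono') auto
  hence "y\<^sup>2 \<le> y powr p" if "y \<noteq> 0"
    using assms that by simp
  moreover have "0 \<le> y ^ 4" by simp
  ultimately show ?thesis by (cases "y = 0") (auto simp: diff_le_eq intro: add_increasing2)
next
  case False
  hence "y\<^sup>2 \<le> y ^ 4" by (intro power_increasing) auto
  thus ?thesis using powr_ge_zero[of y p] by linarith
qed

section \<open>Khinchine's lower bound for Rademacher sums, with sign patterns encoded as subsets,
  and for subset sums\<close>

definition sgn_sum :: "('a \<Rightarrow> complex) \<Rightarrow> 'a set \<Rightarrow> 'a set \<Rightarrow> complex" where
  "sgn_sum u A S = (\<Sum>a\<in>A. if a \<in> S then u a else - u a)"

lemma sum_Pow_insert: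
  assumes "finite A" "a \<notin> A"
  shows "(\<Sum>S\<in>Pow (insert a A). f S) = (\<Sum>S\<in>Pow A. f S + f (insert a S))"
proof -
  have "(\<Sum>S\<in>Pow (insert a A). f S) = (\<Sum>S\<in>Pow A. f S) + (\<Sum>S\<in>insert a ` Pow A. f S)"
    unfolding Pow_insert using assms by (intro sum.union_disjoint) auto
  also have "(\<Sum>S\<in>insert a ` Pow A. f S) = (\<Sum>S\<in>Pow A. f (insert a S))"
    using assms by (subst sum.reindex) (auto simp: inj_on_def)
  finally show ?thesis by (simp add: sum.distrib)
qed

lemma sgn_sum_insert:
  assumes "finite A" "a \<notin> A" "S \<subseteq> A"
  shows "sgn_sum u (insert a A) S = sgn_sum u A S - u a"
    and "sgn_sum u (insert a A) (insert a S) = sgn_sum u A S + u a"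
proof -
  have "(\<Sum>b\<in>A. if b = a \<or> b \<in> S then u b else - u b) = sgn_sum u A S"
    unfolding sgn_sum_def using assms by (intro sum.cong) auto
  thus "sgn_sum u (insert a A) (insert a S) = sgn_sum u A S + u a"
    using assms by (simp add: sgn_sum_def)
  show "sgn_sum u (insert a A) S = sgn_sum u A S - u a"
    using assms by (auto simp: sgn_sum_def)
qed

lemma parallelogram_complex:
  fixes y v :: complex
  shows "(norm (y - v))\<^sup>2 + (norm (y + v))\<^sup>2 = 2 * (norm y)\<^sup>2 + 2 * (norm v)\<^sup>2"
  unfolding cmod_power2 by (simp add: power2_eq_square algebra_simps)

text \<open>The two squared norms are \<open>s - r\<close> and \<open>s + r\<close>, so the cross
  terms cancel in the sum of their squares; Cauchy-Schwarz bounds \<open>r\<^sup>2\<close>.\<close>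

lemma fourth_power_parallelogram:
  fixes y v :: complex
  shows "norm (y - v) ^ 4 + norm (y + v) ^ 4
       \<le> 2 * norm y ^ 4 + 12 * (norm y)\<^sup>2 * (norm v)\<^sup>2 + 2 * norm v ^ 4"
proof -
  define r where "r = 2 * Re (y * cnj v)"
  define s where "s = (norm y)\<^sup>2 + (norm v)\<^sup>2"
  have r: "r\<^sup>2 \<le> 4 * (norm y)\<^sup>2 * (norm v)\<^sup>2"
  proof -
    have "\<bar>r\<bar> \<le> 2 * norm y * norm v"
      using abs_Re_le_cmod[of "y * cnj v"] by (simp add: r_def norm_mult abs_mult)
    hence "\<bar>r\<bar>\<^sup>2 \<le> (2 * norm y * norm v)\<^sup>2" by (intro power_mono) auto
    thus ?thesis by (simp add: power_mult_distrib mult_ac)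
  qed
  have 1: "(norm (y - v))\<^sup>2 = s - r" and 2: "(norm (y + v))\<^sup>2 = s + r"
    unfolding r_def s_def cmod_power2 by (simp_all add: power2_eq_square algebra_simps)
  have "norm (y - v) ^ 4 + norm (y + v) ^ 4 = ((norm (y - v))\<^sup>2)\<^sup>2 + ((norm (y + v))\<^sup>2)\<^sup>2"
    by simp
  also have "\<dots> = 2 * s\<^sup>2 + 2 * r\<^sup>2"
    unfolding 1 2 by (simp add: power2_eq_square algebra_simps)
  also have "\<dots> \<le> 2 * s\<^sup>2 + 2 * (4 * (norm y)\<^sup>2 * (norm v)\<^sup>2)" using r by linarith
  also have "\<dots> = 2 * norm y ^ 4 + 12 * (norm y)\<^sup>2 * (norm v)\<^sup>2 + 2 * norm v ^ 4"
    by (simp add: s_def power2_eq_square power4_eq_xxxx algebra_simps)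
  finally show ?thesis .
qed

text \<open>A new element pairs the two choices of its sign, so the parallelogram estimates apply.
  On average the fourth moment grows by at most \<open>6 * N + 1\<close> when \<open>N\<close>
  elements become \<open>N + 1\<close>, which \<open>3 * N\<^sup>2\<close> absorbs.\<close>

lemma sgn_sum_moments:
  assumes "finite A" and "\<And>a. a \<in> A \<Longrightarrow> norm (u a) = 1"
  shows "(\<Sum>S\<in>Pow A. (norm (sgn_sum u A S))\<^sup>2) = 2 ^ card A * card A"
    and "(\<Sum>S\<in>Pow A. norm (sgn_sum u A S) ^ 4) \<le> 2 ^ card A * (3 * (real (card A))\<^sup>2)"
  using assms
proof (induction A)
  case empty
  case 1 show ?case by (simp add: sgn_sum_def)
  case 2 show ?case by (simp add: sgn_sum_def)
next
  case (insert a A)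
  note IH = insert.IH
  case 1
  have "(\<Sum>S\<in>Pow (insert a A). (norm (sgn_sum u (insert a A) S))\<^sup>2)
      = (\<Sum>S\<in>Pow A. 2 * (norm (sgn_sum u A S))\<^sup>2 + 2)"
    unfolding sum_Pow_insert[OF insert.hyps] using insert.hyps 1
    by (intro sum.cong refl) (auto simp: sgn_sum_insert parallelogram_complex)
  also have "\<dots> = 2 * (2 ^ card A * card A) + 2 * 2 ^ card A"
    using IH(1) 1 insert.hyps by (simp add: sum.distrib sum_distrib_left[symmetric] card_Pow)
  finally show ?case using insert.hyps by (simp add: algebra_simps)
next
  case (insert a A)
  note IH = insert.IH
  case 2
  have "(\<Sum>S\<in>Pow (insert a A). norm (sgn_sum u (insert a A) S) ^ 4)
      = (\<Sum>S\<in>Pow A. norm (sgn_sum u A S - u a) ^ 4 + norm (sgn_sum u A S + u a) ^ 4)"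
    unfolding sum_Pow_insert[OF insert.hyps] using insert.hyps
    by (intro sum.cong refl) (auto simp: sgn_sum_insert)
  also have "\<dots> \<le> (\<Sum>S\<in>Pow A. 2 * norm (sgn_sum u A S) ^ 4 + 12 * (norm (sgn_sum u A S))\<^sup>2 + 2)"
    using 2 by (intro sum_mono order_trans[OF fourth_power_parallelogram]) auto
  also have "\<dots> = 2 * (\<Sum>S\<in>Pow A. norm (sgn_sum u A S) ^ 4) + 12 * (2 ^ card A * card A) + 2 * 2 ^ card A"
    using IH(1) 2 insert.hyps by (simp add: sum.distrib sum_distrib_left[symmetric] card_Pow)
  also have "\<dots> \<le> 2 * (2 ^ card A * (3 * (real (card A))\<^sup>2)) + 12 * (2 ^ card A * card A) + 2 * 2 ^ card A"
    using IH(2) 2 by simp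
  also have "\<dots> \<le> 2 ^ card (insert a A) * (3 * (real (card (insert a A)))\<^sup>2)"
    using insert.hyps by (simp add: power2_eq_square algebra_simps)
  finally show ?case .
qed

lemma sgn_sum_powr_ge:
  assumes "finite A" "A \<noteq> {}" "\<And>a. a \<in> A \<Longrightarrow> norm (u a) = 1" and p: "0 < p" "p \<le> 2"
  shows "2 ^ card A * (sqrt (6 * card A) powr p / 12) \<le> (\<Sum>S\<in>Pow A. norm (sgn_sum u A S) powr p)"
proof -
  \<comment> \<open>With \<open>\<sigma>\<^sup>2 = card A\<close>, the scale \<open>c\<^sup>2 = 6 \<sigma>\<^sup>2\<close> maximises \<open>\<sigma>\<^sup>2 / c\<^sup>2 - 3 \<sigma>\<^sup>4 / c\<^sup>4\<close>; the maximum is \<open>1/12\<close>.\<close>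
  define c where "c = sqrt (6 * card A)"
  have c: "c > 0" "c\<^sup>2 = 6 * card A" "c ^ 4 = 36 * (real (card A))\<^sup>2"
  proof -
    have "card A > 0" using assms by (simp add: card_gt_0_iff)
    thus "c > 0" and c2: "c\<^sup>2 = 6 * card A" by (simp_all add: c_def)
    have "c ^ 4 = (c\<^sup>2)\<^sup>2" by simp
    thus "c ^ 4 = 36 * (real (card A))\<^sup>2" by (simp only: c2 power_mult_distrib) simp
  qed
  have N: "real (card A) > 0" using assms by (simp add: card_gt_0_iff)
  note mom = sgn_sum_moments[OF assms(1,3)]
  have "2 ^ card A / 12 = 2 ^ card A * card A / c\<^sup>2 - 2 ^ card A * (3 * (real (card A))\<^sup>2) / c ^ 4"
    unfolding c using N by (simp add: field_simps)
  also have "\<dots> \<le> (\<Sum>S\<in>Pow A. (norm (sgn_sum u A S))\<^sup>2) / c\<^sup>2 - (\<Sum>S\<in>Pow A. norm (sgn_sum u A S) ^ 4) / c ^ 4"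
    using mom c by (intro diff_mono divide_right_mono) auto
  also have "\<dots> = (\<Sum>S\<in>Pow A. (norm (sgn_sum u A S) / c)\<^sup>2 - (norm (sgn_sum u A S) / c) ^ 4)"
    by (simp add: sum_subtractf sum_divide_distrib power_divide)
  also have "\<dots> \<le> (\<Sum>S\<in>Pow A. (norm (sgn_sum u A S) / c) powr p)"
    using p c by (intro sum_mono sq_minus_fourth_le_powr) auto
  also have "\<dots> = (\<Sum>S\<in>Pow A. norm (sgn_sum u A S) powr p) / c powr p"
    using c by (simp add: powr_divide sum_divide_distrib)
  finally show ?thesis using c by (simp add: field_simps c_def)
qed

text \<open>Replaces the triangle inequality of the \<open>p\<close>-norm, which fails for
  \<open>p < 1\<close>.\<close>

lemma norm_diff_powr_le:
  fixes x y :: "'a::real_normed_vector"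
  assumes "0 < p"
  shows "norm (x - y) powr p \<le> 2 powr p * (norm x powr p + norm y powr p)"
proof -
  have "norm (x - y) \<le> 2 * max (norm x) (norm y)"
    using norm_triangle_ineq4[of x y] by linarith
  hence "norm (x - y) powr p \<le> (2 * max (norm x) (norm y)) powr p"
    using assms by (intro powr_mono2) auto
  also have "\<dots> = 2 powr p * max (norm x) (norm y) powr p"
    by (simp add: powr_mult)
  also have "max (norm x) (norm y) powr p \<le> norm x powr p + norm y powr p"
    by (simp add: max_def)
  finally show ?thesis by simp
qed

lemma sum_Pow_compl:
  "finite A \<Longrightarrow> (\<Sum>S\<in>Pow A. f (A - S)) = (\<Sum>S\<in>Pow A. f S)"
  by (rule sum.reindex_bij_witness[of _ "\<lambda>S. A - S" "\<lambda>S. A - S"]) (auto simp: double_diff)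

text \<open>A sign sum is the sum over \<open>S\<close> minus the sum over its complement.
  Complementation permutes the subsets, so both parts contribute equally, which halves 1/12 to
  1/24.\<close>

lemma subset_sum_powr_ge:
  fixes u :: "'a \<Rightarrow> complex"
  assumes "finite A" "A \<noteq> {}" "\<And>a. a \<in> A \<Longrightarrow> norm (u a) = 1" and p: "0 < p" "p \<le> 2"
  shows "2 ^ card A * (sqrt (card A) powr p / 24) \<le> (\<Sum>S\<in>Pow A. norm (\<Sum>a\<in>S. u a) powr p)"
proof -
  define g where "g = (\<lambda>S. \<Sum>a\<in>S. u a)"
  have "sgn_sum u A S = g S - g (A - S)" if "S \<subseteq> A" for S
    unfolding sgn_sum_def g_def using that assms(1)
    by (simp add: sum.If_cases sum_negf Int_absorb1 Diff_eq[symmetric])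
  hence "(\<Sum>S\<in>Pow A. norm (sgn_sum u A S) powr p)
       \<le> (\<Sum>S\<in>Pow A. 2 powr p * (norm (g S) powr p + norm (g (A - S)) powr p))"
    using p by (intro sum_mono) (simp add: norm_diff_powr_le)
  also have "\<dots> = 2 powr p * (2 * (\<Sum>S\<in>Pow A. norm (g S) powr p))"
    using sum_Pow_compl[OF assms(1), of "\<lambda>S. norm (g S) powr p"]
    by (simp add: sum_distrib_left[symmetric] sum.distrib)
  finally have "2 ^ card A * (sqrt (6 * card A) powr p / 12) \<le> 2 powr p * (2 * (\<Sum>S\<in>Pow A. norm (g S) powr p))"
    using sgn_sum_powr_ge[OF assms(1,2) _ p, of u] assms(3) by fastforce
  \<comment> \<open>The slack between 6 and 4 under the root pays for the factor
    \<open>2 powr p\<close> of the quasi-triangle inequality.\<close>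
  moreover have "2 powr p * sqrt (card A) powr p \<le> sqrt (6 * card A) powr p"
  proof -
    have "2 * sqrt (card A) = sqrt (4 * card A)" by (simp add: real_sqrt_mult)
    hence "2 * sqrt (card A) \<le> sqrt (6 * card A)" by simp
    hence "(2 * sqrt (card A)) powr p \<le> sqrt (6 * card A) powr p"
      using p by (intro powr_mono2) auto
    thus ?thesis by (simp add: powr_mult)
  qed
  ultimately have "2 ^ card A * (2 powr p * sqrt (card A) powr p / 12) \<le> 2 powr p * (2 * (\<Sum>S\<in>Pow A. norm (g S) powr p))"
    by (smt (verit) divide_right_mono mult_left_mono zero_le_power)
  hence "2 powr p * (2 ^ card A * (sqrt (card A) powr p / 24)) \<le> 2 powr p * (\<Sum>S\<in>Pow A. norm (g S) powr p)"
    by (simp add: field_simps)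
  thus ?thesis unfolding g_def by (subst (asm) mult_le_cancel_left_pos) auto
qed

subsection \<open>Moments of polynomials on the torus\<close>

lemma dilated_polynomial_measurable [measurable]:
  fixes m :: "'x \<Rightarrow> nat \<Rightarrow> nat"
  shows "(\<lambda>z. \<Sum>x\<in>Y. \<Prod>j<d. (c * z j) ^ m x j) \<in> borel_measurable (torus d)"
  by (intro borel_measurable_sum borel_measurable_prod borel_measurable_power borel_measurable_times
        torus_component_measurable) auto

lemma norm_dilated_polynomial_le:
  fixes m :: "'x \<Rightarrow> nat \<Rightarrow> nat" and c :: complex
  assumes "\<forall>j<d. norm (z j) = 1" "norm c \<le> 1"
  shows "norm (\<Sum>x\<in>Y. \<Prod>j<d. (c * z j) ^ m x j) \<le> card Y"
proof -
  have "norm (\<Sum>x\<in>Y. \<Prod>j<d. (c * z j) ^ m x j) \<le> (\<Sum>x\<in>Y. 1)"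
    using assms
    by (intro order_trans[OF norm_sum] sum_mono)
       (auto simp: prod_norm[symmetric] norm_mult norm_power intro!: prod_le_1 power_le_one)
  thus ?thesis by simp
qed

lemma polynomial_powr_integrable:
  fixes m :: "'x \<Rightarrow> nat \<Rightarrow> nat"
  assumes "0 \<le> p"
  shows "integrable (torus d) (\<lambda>z. norm (\<Sum>x\<in>Y. \<Prod>j<d. z j ^ m x j) powr p)"
proof -
  interpret prob_space "torus d" by (rule prob_space_torus)
  show ?thesis
  proof (rule integrable_const_bound[where B = "real (card Y) powr p"])
    show "AE z in torus d. norm (norm (\<Sum>x\<in>Y. \<Prod>j<d. z j ^ m x j) powr p) \<le> card Y powr p"
      using AE_torus[of d]
    proof eventually_elim
      case (elim z)
      from norm_dilated_polynomial_le[OF elim, where c = 1 and Y = Y and m = m] show ?case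
        using assms by (auto intro!: powr_mono2)
    qed
    show "(\<lambda>z. norm (\<Sum>x\<in>Y. \<Prod>j<d. z j ^ m x j) powr p) \<in> borel_measurable (torus d)"
      using dilated_polynomial_measurable[where Y = Y and c = 1 and m = m and d = d] by simp
  qed
qed

text \<open>On the closed polydisc the polynomial is bounded by its number of terms, so dominated
  convergence carries the bound from the radii below 1 to the torus.\<close>

lemma polynomial_moment_le_of_Hp_radial_norm_le:
  fixes m :: "'x \<Rightarrow> nat \<Rightarrow> nat"
  assumes p: "0 < p" and B: "0 \<le> B"
    and le: "Hp_radial_norm d p (\<lambda>z. \<Sum>x\<in>Y. \<Prod>j<d. z j ^ m x j) \<le> ereal B"
  shows "(\<integral>z. norm (\<Sum>x\<in>Y. \<Prod>j<d. z j ^ m x j) powr p \<partial>torus d) \<le> B powr p"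
proof -
  interpret prob_space "torus d" by (rule prob_space_torus)
  define g where "g = (\<lambda>r z. norm (\<Sum>x\<in>Y. \<Prod>j<d. (complex_of_real r * z j) ^ m x j) powr p)"
  \<comment> \<open>The double successor keeps \<open>r 0 = 1/2\<close> strictly positive.\<close>
  define r where "r = (\<lambda>n. 1 - inverse (real (Suc (Suc n))))"
  have r: "r n \<in> {0<..<1}" for n by (auto simp: r_def field_simps)
  have r_lim: "r \<longlonglongrightarrow> 1"
    unfolding r_def
    using tendsto_diff[OF tendsto_const[of 1] LIMSEQ_Suc[OF LIMSEQ_inverse_real_of_nat]] by simp
  have le_n: "(\<integral>z. g (r n) z \<partial>torus d) \<le> B powr p" for n
  proof -
    have "ereal ((\<integral>z. g (r n) z \<partial>torus d) powr (1 / p)) \<le> ereal B"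
      using le r[of n] unfolding Hp_radial_norm_def g_def by (auto simp: SUP_le_iff)
    hence "((\<integral>z. g (r n) z \<partial>torus d) powr (1 / p)) powr p \<le> B powr p"
      using p B by (intro powr_mono2) auto
    moreover have "(\<integral>z. g (r n) z \<partial>torus d) \<ge> 0"
      unfolding g_def by (intro integral_nonneg_AE) auto
    ultimately show ?thesis using p by (simp add: powr_powr)
  qed
  have "(\<lambda>n. \<integral>z. g (r n) z \<partial>torus d) \<longlonglongrightarrow> (\<integral>z. g 1 z \<partial>torus d)"
  proof (rule integral_dominated_convergence[where w = "\<lambda>_. card Y powr p"])
    show "g 1 \<in> borel_measurable (torus d)" "g (r n) \<in> borel_measurable (torus d)" for n
      unfolding g_def by measurable
    show "AE z in torus d. (\<lambda>n. g (r n) z) \<longlonglongrightarrow> g 1 z"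
      unfolding g_def using p r_lim by (intro AE_I2 tendsto_intros) auto
    show "AE z in torus d. norm (g (r n) z) \<le> card Y powr p" for n
      using AE_torus[of d]
    proof eventually_elim
      case (elim z)
      have "norm (complex_of_real (r n)) \<le> 1" using r[of n] by simp
      from norm_dilated_polynomial_le[OF elim this, where Y = Y and m = m] show ?case
        using p by (auto simp: g_def intro!: powr_mono2)
    qed
  qed auto
  hence "(\<integral>z. g 1 z \<partial>torus d) \<le> B powr p"
    by (rule LIMSEQ_le_const2) (use le_n in auto)
  thus ?thesis by (simp add: g_def)
qed

text \<open>Monotonicity of \<open>p\<close>-norms on a probability space, obtained by integrating a
  pointwise weighted AM-GM between \<open>f x powr p'\<close> and the constant
  \<open>B powr p'\<close>.\<close>

lemma (in prob_space) powr_moment_mono: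
  fixes f :: "'a \<Rightarrow> real" and p p' B :: real
  assumes "0 < p" "p \<le> p'" "0 < B" and nonneg: "\<And>x. 0 \<le> f x"
    and int: "integrable M (\<lambda>x. f x powr p)" "integrable M (\<lambda>x. f x powr p')"
    and le: "(\<integral>x. f x powr p' \<partial>M) \<le> B powr p'"
  shows "(\<integral>x. f x powr p \<partial>M) \<le> B powr p"
proof (cases "p = p'")
  case False
  define \<theta> where "\<theta> = p / p'"
  have \<theta>: "0 < \<theta>" "\<theta> < 1" using assms False by (auto simp: \<theta>_def)
  define D where "D = (B powr p') powr (1 - \<theta>)"
  have D: "D > 0" using assms by (simp add: D_def)
  have "(\<integral>x. f x powr p \<partial>M) * D = (\<integral>x. f x powr p * D \<partial>M)" by simp
  also have "\<dots> \<le> (\<integral>x. \<theta> * f x powr p' + (1 - \<theta>) * B powr p' \<partial>M)"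
  proof (rule integral_mono)
    fix x
    have "f x powr p * D = (f x powr p') powr \<theta> * D"
      using assms by (simp add: powr_powr \<theta>_def)
    also have "\<dots> \<le> \<theta> * f x powr p' + (1 - \<theta>) * B powr p'"
      unfolding D_def using \<theta> by (intro weighted_arith_geom_powr) auto
    finally show "f x powr p * D \<le> \<theta> * f x powr p' + (1 - \<theta>) * B powr p'" .
  qed (use int in auto)
  also have "\<dots> = \<theta> * (\<integral>x. f x powr p' \<partial>M) + (1 - \<theta>) * B powr p'"
    using int by (simp add: prob_space)
  also have "\<dots> \<le> \<theta> * B powr p' + (1 - \<theta>) * B powr p'"
    using le \<theta> by simp
  also have "\<dots> = B powr p * D"
    using assms by (simp add: D_def powr_powr powr_add[symmetric] \<theta>_def field_simps)
  finally show ?thesis using D by simp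
qed (use le in simp)

section \<open>Products of powers and rotated circle averages, for use with the cube
  functions\<close>

lemma power_int_sum:
  fixes z :: "'a :: field"
  assumes "z \<noteq> 0"
  shows "z powi (\<Sum>i\<in>A. f i) = (\<Prod>i\<in>A. z powi f i)"
  by (induction A rule: infinite_finite_induct) (auto simp: power_int_add assms)

lemma circle_integral_affine_Re:
  "integrable circle_measure (\<lambda>z. a + b * Re (z * w) - c * Re ((z * w)\<^sup>2))"
  "(\<integral>z. a + b * Re (z * w) - c * Re ((z * w)\<^sup>2) \<partial>circle_measure) = a"
proof -
  interpret prob_space circle_measure by (rule prob_space_circle_measure)
  have i: "integrable circle_measure (\<lambda>z. z)" "integrable circle_measure (\<lambda>z. z\<^sup>2)"
    and e: "(\<integral>z. z \<partial>circle_measure) = 0" "(\<integral>z. z\<^sup>2 \<partial>circle_measure) = 0"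
    using circle_integral_powi[of 1] circle_integral_powi[of 2] by simp_all
  have i': "integrable circle_measure (\<lambda>z. z * w)" "integrable circle_measure (\<lambda>z. (z * w)\<^sup>2)"
    using i by (auto simp: power_mult_distrib)
  have e': "(\<integral>z. z * w \<partial>circle_measure) = 0" "(\<integral>z. (z * w)\<^sup>2 \<partial>circle_measure) = 0"
    using i e by (simp_all add: power_mult_distrib)
  have i'': "integrable circle_measure (\<lambda>z. Re (z * w))" "integrable circle_measure (\<lambda>z. Re ((z * w)\<^sup>2))"
    by (rule integrable_Re[OF i'(1)], rule integrable_Re[OF i'(2)])
  have e'': "(\<integral>z. Re (z * w) \<partial>circle_measure) = 0" "(\<integral>z. Re ((z * w)\<^sup>2) \<partial>circle_measure) = 0"
    using integral_Re[OF i'(1)] integral_Re[OF i'(2)] unfolding e' by (simp_all del: times_complex.sel)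
  show "integrable circle_measure (\<lambda>z. a + b * Re (z * w) - c * Re ((z * w)\<^sup>2))"
    using i'' by (intro Bochner_Integration.integrable_add Bochner_Integration.integrable_diff integrable_mult_right) auto
  show "(\<integral>z. a + b * Re (z * w) - c * Re ((z * w)\<^sup>2) \<partial>circle_measure) = a"
    using Bochner_Integration.integral_diff[OF Bochner_Integration.integrable_add[OF _ integrable_mult_right[OF i''(1)]]
        integrable_mult_right[OF i''(2)], of "\<lambda>_. a" b c]
      Bochner_Integration.integral_add[OF _ integrable_mult_right[OF i''(1)], of "\<lambda>_. a" b]
    by (simp add: e'' prob_space.prob_space[OF prob_space_circle_measure] del: times_complex.sel)
qed

subsection \<open>The cube construction\<close>

text \<open>
  The frequencies are indexed by subsets \<open>X\<close> of \<open>{..<k}\<close>; \<open>e\<close> enumerates the vertices along the extra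
  coordinates. The middle case is \<open>dist(X, e j) - 1\<close> for \<open>e j \<notin> S\<close>. Keeping the exponent \<open>dist(X, e j)\<close>
  for \<open>e j \<in> S\<close> makes \<open>S\<close> enter the monomials only through the common unimodular factor \<open>phase S\<close>,
  so that the averaging over \<open>S\<close> can be done pointwise.
\<close>

definition cube_exp :: "nat \<Rightarrow> (nat \<Rightarrow> nat set) \<Rightarrow> nat set set \<Rightarrow> nat set \<Rightarrow> nat \<Rightarrow> int" where
  "cube_exp k e S X j =
     (if j < k then of_bool (j \<in> X)
      else if j < k + 2 ^ k then
        int (card (e j)) + (\<Sum>i\<in>X. if i \<in> e j then -1 else 1) - of_bool (e j \<notin> S)
      else 0)"

definition cube_fun :: "nat \<Rightarrow> nat \<Rightarrow> (nat \<Rightarrow> nat set) \<Rightarrow> nat set set \<Rightarrow> (nat \<Rightarrow> complex) \<Rightarrow> complex" where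
  "cube_fun d k e S z = (\<Sum>X\<in>Pow {..<k}. \<Prod>j<d. z j powi cube_exp k e S X j)"

text \<open>Each \<open>i\<close> in \<open>X\<close> adds 1 if it lies outside \<open>e j\<close>
  and removes 1 from \<open>card (e j)\<close> otherwise; the result is the size of the symmetric
  difference, less the offset.\<close>

lemma cube_exp_eq_card:
  assumes "k \<le> j" "j < k + 2 ^ k" "finite X" "finite (e j)"
  shows "cube_exp k e S X j = int (card (e j - X) + card (X - e j)) - of_bool (e j \<notin> S)"
proof -
  have "(\<Sum>i\<in>X. if i \<in> e j then -1 else 1)
      = (\<Sum>i\<in>X \<inter> e j. -1) + (\<Sum>i\<in>X - e j. (1 :: int))"
    using assms(3) by (simp only: sum.If_cases Diff_eq Collect_mem_eq Collect_neg_eq)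
  hence "(\<Sum>i\<in>X. if i \<in> e j then -1 else 1) = int (card (X - e j)) - int (card (X \<inter> e j))"
    by simp
  moreover have "card (e j) = card (e j - X) + card (X \<inter> e j)"
    using card_Int_Diff[OF assms(4), of X] by (simp add: Int_commute)
  ultimately show ?thesis using assms by (simp add: cube_exp_def)
qed

context
  fixes d k :: nat and e :: "nat \<Rightarrow> nat set"
  assumes e: "bij_betw e {k..<k + 2 ^ k} (Pow {..<k})" and d: "k + 2 ^ k \<le> d"
begin

lemma cube_label_subset: "k \<le> j \<Longrightarrow> j < k + 2 ^ k \<Longrightarrow> e j \<subseteq> {..<k}"
  using e by (auto simp: bij_betw_def)

text \<open>If \<open>X\<close> is not in \<open>S\<close>, the coordinate labelled by
  \<open>X\<close> itself has distance 0 and exponent -1. If \<open>X\<close> is in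
  \<open>S\<close>, every label outside \<open>S\<close> differs from \<open>X\<close>, so its
  distance is at least 1.\<close>

lemma cube_exp_nonneg_iff:
  assumes X: "X \<subseteq> {..<k}"
  shows "(\<forall>j<d. 0 \<le> cube_exp k e S X j) \<longleftrightarrow> X \<in> S"
proof
  assume nonneg: "\<forall>j<d. 0 \<le> cube_exp k e S X j"
  obtain j where j: "k \<le> j" "j < k + 2 ^ k" "e j = X"
  proof -
    have "X \<in> e ` {k..<k + 2 ^ k}" using e X by (simp add: bij_betw_def)
    thus ?thesis using that by auto
  qed
  have "finite X" using X finite_subset by blast
  hence "cube_exp k e S X j = - of_bool (X \<notin> S)"
    using j by (simp add: cube_exp_eq_card)
  moreover have "0 \<le> cube_exp k e S X j" using nonneg j(2) d by simp
  ultimately show "X \<in> S" by (cases "X \<in> S") simp_all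
next
  assume "X \<in> S"
  show "\<forall>j<d. 0 \<le> cube_exp k e S X j"
  proof (intro allI impI)
    fix j assume "j < d"
    consider "j < k \<or> j \<ge> k + 2 ^ k" | "k \<le> j" "j < k + 2 ^ k" by linarith
    thus "0 \<le> cube_exp k e S X j"
    proof cases
      case 2
      have fin: "finite X" "finite (e j)" using X cube_label_subset[OF 2] finite_subset by blast+
      have "card (e j - X) + card (X - e j) \<ge> 1" if "e j \<notin> S"
      proof -
        have "e j \<noteq> X" using that \<open>X \<in> S\<close> by auto
        hence "e j - X \<noteq> {} \<or> X - e j \<noteq> {}" by auto
        thus ?thesis using fin by (auto simp: Suc_le_eq card_gt_0_iff)
      qed
      thus ?thesis unfolding cube_exp_eq_card[where e = e and j = j, OF 2 fin] by (cases "e j \<in> S") simp_all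
    qed (auto simp: cube_exp_def)
  qed
qed

lemma cube_exp_inj:
  assumes "X \<subseteq> {..<k}" "Y \<subseteq> {..<k}" "\<forall>j<d. cube_exp k e S X j = cube_exp k e S Y j"
  shows "X = Y"
proof -
  have "i \<in> X \<longleftrightarrow> i \<in> Y" if "i < k" for i
    using assms(3)[rule_format, of i] that d by (auto simp: cube_exp_def of_bool_def split: if_splits)
  thus ?thesis using assms by auto
qed

lemma riesz_proj_cube_fun:
  assumes "S \<subseteq> Pow {..<k}"
  shows "riesz_proj d (cube_fun d k e S) = (\<lambda>w. \<Sum>X\<in>S. \<Prod>j<d. w j ^ nat (cube_exp k e S X j))"
proof
  fix w
  have "{X \<in> Pow {..<k}. \<forall>j<d. 0 \<le> cube_exp k e S X j} = S"
  proof -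
    have "{X \<in> Pow {..<k}. \<forall>j<d. 0 \<le> cube_exp k e S X j} = {X \<in> Pow {..<k}. X \<in> S}"
      by (intro Collect_cong conj_cong refl cube_exp_nonneg_iff) auto
    thus ?thesis using assms by auto
  qed
  thus "riesz_proj d (cube_fun d k e S) w = (\<Sum>X\<in>S. \<Prod>j<d. w j ^ nat (cube_exp k e S X j))"
    unfolding cube_fun_def using cube_exp_inj by (subst riesz_proj_trig_poly) auto
qed

text \<open>The factor that the extra variables attach to \<open>z i\<close>. It reads only
  coordinates from \<open>k\<close> on, which permits integrating over the first \<open>k\<close>
  variables with it held fixed.\<close>

definition twist :: "(nat \<Rightarrow> complex) \<Rightarrow> nat \<Rightarrow> complex" where
  "twist z i = (\<Prod>j\<in>{k..<k + 2 ^ k}. z j powi (if i \<in> e j then -1 else 1))"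

definition phase :: "nat set set \<Rightarrow> (nat \<Rightarrow> complex) \<Rightarrow> complex" where
  "phase S z = (\<Prod>j\<in>{k..<k + 2 ^ k}. z j powi (int (card (e j)) - of_bool (e j \<notin> S)))"

text \<open>Each extra exponent is a constant plus a sum over \<open>X\<close>; exchanging the two
  products collects the summands belonging to \<open>i\<close> into
  \<open>twist z i\<close>.\<close>

lemma cube_monomial_eq:
  assumes "\<forall>j<d. norm (z j) = 1" and X: "X \<subseteq> {..<k}"
  shows "(\<Prod>j<d. z j powi cube_exp k e S X j) = phase S z * (\<Prod>i\<in>X. z i * twist z i)"
proof -
  define K where "K = {k..<k + 2 ^ k}"
  have nz: "z j \<noteq> 0" if "j < d" for j using assms(1) that by force
  have Kd: "j < d" if "j \<in> K" for j using that d by (simp add: K_def)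
  have "(\<Prod>j<d. z j powi cube_exp k e S X j) = (\<Prod>j\<in>{..<k} \<union> K. z j powi cube_exp k e S X j)"
    using d by (intro prod.mono_neutral_right) (auto simp: K_def cube_exp_def)
  also have "\<dots> = (\<Prod>j<k. z j powi cube_exp k e S X j) * (\<Prod>j\<in>K. z j powi cube_exp k e S X j)"
    by (intro prod.union_disjoint) (auto simp: K_def)
  also have "(\<Prod>j<k. z j powi cube_exp k e S X j) = (\<Prod>i\<in>X. z i)"
  proof -
    have "(\<Prod>j<k. z j powi cube_exp k e S X j) = (\<Prod>j<k. if j \<in> X then z j else 1)"
      by (intro prod.cong) (auto simp: cube_exp_def)
    also have "\<dots> = (\<Prod>i\<in>X. z i)"
      using X by (simp add: prod.If_cases Int_absorb1)
    finally show ?thesis .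
  qed
  also have "(\<Prod>j\<in>K. z j powi cube_exp k e S X j)
      = (\<Prod>j\<in>K. z j powi (int (card (e j)) - of_bool (e j \<notin> S)) * (\<Prod>i\<in>X. z j powi (if i \<in> e j then -1 else 1)))"
  proof (intro prod.cong refl)
    fix j assume j: "j \<in> K"
    have "cube_exp k e S X j
        = (int (card (e j)) - of_bool (e j \<notin> S)) + (\<Sum>i\<in>X. if i \<in> e j then -1 else 1)"
      using j by (simp add: cube_exp_def K_def)
    thus "z j powi cube_exp k e S X j
        = z j powi (int (card (e j)) - of_bool (e j \<notin> S)) * (\<Prod>i\<in>X. z j powi (if i \<in> e j then -1 else 1))"
      using nz[OF Kd[OF j]] by (simp only: power_int_add power_int_sum simp_thms)
  qed
  also have "\<dots> = phase S z * (\<Prod>i\<in>X. twist z i)"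
    unfolding phase_def twist_def K_def prod.distrib by (subst (2) prod.swap) (rule refl)
  finally show ?thesis by (simp add: prod.distrib mult_ac)
qed

lemma norm_twist: "\<forall>j<d. norm (z j) = 1 \<Longrightarrow> norm (twist z i) = 1"
  using d by (auto simp: twist_def norm_power_int prod_norm[symmetric])

lemma norm_phase: "\<forall>j<d. norm (z j) = 1 \<Longrightarrow> norm (phase S z) = 1"
  using d by (auto simp: phase_def norm_power_int prod_norm[symmetric])

text \<open>The sum over all \<open>X\<close> is the expansion of a product, and the common phase is
  unimodular; hence the modulus does not depend on \<open>S\<close>.\<close>

lemma norm_cube_fun:
  assumes "\<forall>j<d. norm (z j) = 1"
  shows "norm (cube_fun d k e S z) = (\<Prod>i<k. norm (1 + z i * twist z i))"
proof -
  have "cube_fun d k e S z = phase S z * (\<Sum>X\<in>Pow {..<k}. \<Prod>i\<in>X. z i * twist z i)"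
    unfolding cube_fun_def sum_distrib_left using assms
    by (intro sum.cong refl) (simp add: cube_monomial_eq)
  also have "(\<Sum>X\<in>Pow {..<k}. \<Prod>i\<in>X. z i * twist z i) = (\<Prod>i<k. 1 + z i * twist z i)"
    using prod_add[of "{..<k}" "\<lambda>i. z i * twist z i" "\<lambda>_. 1"] by (simp add: add.commute)
  finally show ?thesis using norm_phase[OF assms] by (simp add: norm_mult prod_norm)
qed

lemma twist_measurable: "(\<lambda>z. twist z i) \<in> borel_measurable (torus d)"
proof -
  have "(\<lambda>z. z j powi (if i \<in> e j then -1 else 1)) \<in> borel_measurable (torus d)"
    if "j \<in> {k..<k + 2 ^ k}" for j
    using that d torus_component_measurable[of j d] by (cases "i \<in> e j") simp_all
  thus ?thesis unfolding twist_def by (intro borel_measurable_prod)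
qed

lemma cube_fun_measurable: "cube_fun d k e S \<in> borel_measurable (torus d)"
  unfolding cube_fun_def by (intro borel_measurable_sum torus_monomial_measurable)

text \<open>Fubini: with the extra variables fixed, each twist is a constant rotation, the integrand
  factors over the first \<open>k\<close> circles, and each factor has mean
  \<open>a\<close>.\<close>

lemma torus_integral_prod_twist:
  fixes a b c :: real
  defines "h \<equiv> \<lambda>\<zeta>. a + b * Re \<zeta> - c * Re (\<zeta>\<^sup>2)"
  shows "integrable (torus d) (\<lambda>z. \<Prod>i<k. h (z i * twist z i))" (is ?int)
    and "(\<integral>z. (\<Prod>i<k. h (z i * twist z i)) \<partial>torus d) = a ^ k"
proof -
  interpret prob_space "torus d" by (rule prob_space_torus)
  have h: "\<bar>h \<zeta>\<bar> \<le> \<bar>a\<bar> + \<bar>b\<bar> + \<bar>c\<bar>" if "norm \<zeta> = 1" for \<zeta>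
  proof -
    have "\<bar>Re \<zeta>\<bar> \<le> 1" "\<bar>Re (\<zeta>\<^sup>2)\<bar> \<le> 1"
      using abs_Re_le_cmod[of \<zeta>] abs_Re_le_cmod[of "\<zeta>\<^sup>2"] that by (simp_all add: norm_power)
    hence "\<bar>b * Re \<zeta>\<bar> \<le> \<bar>b\<bar>" "\<bar>c * Re (\<zeta>\<^sup>2)\<bar> \<le> \<bar>c\<bar>"
      by (simp_all add: abs_mult mult_left_le)
    thus ?thesis unfolding h_def by linarith
  qed
  have h_meas: "h \<in> borel_measurable borel"
    unfolding h_def by (intro borel_measurable_continuous_onI continuous_intros)
  show int: ?int
  proof (rule integrable_const_bound[where B = "(\<bar>a\<bar> + \<bar>b\<bar> + \<bar>c\<bar>) ^ k"])
    show "AE z in torus d. norm (\<Prod>i<k. h (z i * twist z i)) \<le> (\<bar>a\<bar> + \<bar>b\<bar> + \<bar>c\<bar>) ^ k"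
      using AE_torus[of d]
    proof eventually_elim
      case (elim z)
      have "(\<Prod>i<k. \<bar>h (z i * twist z i)\<bar>) \<le> (\<Prod>i<k. \<bar>a\<bar> + \<bar>b\<bar> + \<bar>c\<bar>)"
        using elim d by (intro prod_mono conjI h) (auto simp: norm_mult norm_twist)
      thus ?case by (simp add: abs_prod)
    qed
    have "(\<lambda>z. z i * twist z i) \<in> borel_measurable (torus d)" if "i < k" for i
      using that d by (intro borel_measurable_times torus_component_measurable twist_measurable) auto
    thus "(\<lambda>z. \<Prod>i<k. h (z i * twist z i)) \<in> borel_measurable (torus d)"
      by (intro borel_measurable_prod measurable_compose[OF _ h_meas]) auto
  qed
  \<comment> \<open>This order of the union makes the extra coordinates the outer
    integration.\<close>
  have Un: "{k..<d} \<union> {..<k} = {..<d}" using d by auto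
  have "(\<integral>z. (\<Prod>i<k. h (z i * twist z i)) \<partial>torus d)
      = (\<integral>x. (\<integral>y. (\<Prod>i<k. h (merge {k..<d} {..<k} (x, y) i * twist (merge {k..<d} {..<k} (x, y)) i))
            \<partial>PiM {..<k} (\<lambda>_. circle_measure)) \<partial>PiM {k..<d} (\<lambda>_. circle_measure))"
    using int unfolding torus_def Un[symmetric]
    by (intro circle.product_integral_fold) auto
  also have "\<dots> = (\<integral>x. (\<integral>y. (\<Prod>i<k. h (y i * twist x i))
            \<partial>PiM {..<k} (\<lambda>_. circle_measure)) \<partial>PiM {k..<d} (\<lambda>_. circle_measure))"
  proof (intro Bochner_Integration.integral_cong refl prod.cong)
    fix x y i assume "i \<in> {..<k}"
    moreover have "twist (merge {k..<d} {..<k} (x, y)) i = twist x i"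
      unfolding twist_def using d by (intro prod.cong) (auto simp: merge_def)
    ultimately show "h (merge {k..<d} {..<k} (x, y) i * twist (merge {k..<d} {..<k} (x, y)) i)
        = h (y i * twist x i)"
      by (simp add: merge_def)
  qed
  also have "\<dots> = (\<integral>x. (\<Prod>i<k. (\<integral>y. h (y * twist x i) \<partial>circle_measure)) \<partial>PiM {k..<d} (\<lambda>_. circle_measure))"
    unfolding h_def
    by (intro Bochner_Integration.integral_cong refl circle.product_integral_prod circle_integral_affine_Re) auto
  also have "\<dots> = (\<integral>x. a ^ k \<partial>PiM {k..<d} (\<lambda>_. circle_measure))"
    unfolding h_def circle_integral_affine_Re by simp
  also have "\<dots> = a ^ k"
    by (simp add: prob_space.prob_space[OF prob_space_PiM[OF prob_space_circle_measure]])
  finally show "(\<integral>z. (\<Prod>i<k. h (z i * twist z i)) \<partial>torus d) = a ^ k" .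
qed

text \<open>The product of the pointwise majorants of \<open>norm_one_plus_powr_le\<close> has an
  exactly computable integral, with one factor \<open>1 - c\<close> per cube dimension.\<close>

lemma cube_fun_Lq:
  assumes q: "1 \<le> q" "q < 2"
  shows "in_Lq d q (cube_fun d k e S)"
    and "Lq_norm d q (cube_fun d k e S) \<le> (sqrt 2 * (1 - (2 - q) / 24) powr (1 / q)) ^ k"
proof -
  interpret prob_space "torus d" by (rule prob_space_torus)
  define c where "c = (2 - q) / 24"
  define h where "h = (\<lambda>\<zeta>. 1 - c + q / 2 * Re \<zeta> - c * Re (\<zeta>\<^sup>2))"
  have c: "0 < 1 - c" using q by (simp add: c_def)
  have int: "integrable (torus d) (\<lambda>z. \<Prod>i<k. h (z i * twist z i))"
    "(\<integral>z. (\<Prod>i<k. h (z i * twist z i)) \<partial>torus d) = (1 - c) ^ k"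
    unfolding h_def by (rule torus_integral_prod_twist)+
  have le: "AE z in torus d. norm (cube_fun d k e S z) powr q \<le> (2 powr (q / 2)) ^ k * (\<Prod>i<k. h (z i * twist z i))"
    using AE_torus[of d]
  proof eventually_elim
    case (elim z)
    have "norm (cube_fun d k e S z) powr q = (\<Prod>i<k. norm (1 + z i * twist z i) powr q)"
      using norm_cube_fun[OF elim] by (simp add: prod_powr_distrib)
    also have "\<dots> \<le> (\<Prod>i<k. 2 powr (q / 2) * h (z i * twist z i))"
      unfolding h_def c_def using elim d q
      by (intro prod_mono conjI norm_one_plus_powr_le) (auto simp: norm_mult norm_twist)
    finally show ?case by (simp add: prod.distrib)
  qed
  have int_rhs: "integrable (torus d) (\<lambda>z. (2 powr (q / 2)) ^ k * (\<Prod>i<k. h (z i * twist z i)))"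
    using int(1) by simp
  have int_lhs: "integrable (torus d) (\<lambda>z. norm (cube_fun d k e S z) powr q)"
    using cube_fun_measurable le
    by (intro Bochner_Integration.integrable_bound[OF int_rhs])
       (auto elim!: eventually_mono)
  show "in_Lq d q (cube_fun d k e S)"
    unfolding in_Lq_def using int_lhs cube_fun_measurable by simp
  have "(\<integral>z. norm (cube_fun d k e S z) powr q \<partial>torus d)
      \<le> (\<integral>z. (2 powr (q / 2)) ^ k * (\<Prod>i<k. h (z i * twist z i)) \<partial>torus d)"
    by (rule integral_mono_AE[OF int_lhs int_rhs le])
  also have "\<dots> = (2 powr (q / 2) * (1 - c)) ^ k"
    using int(2) by (simp add: power_mult_distrib)
  finally have "Lq_norm d q (cube_fun d k e S) \<le> ((2 powr (q / 2) * (1 - c)) ^ k) powr (1 / q)"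
    unfolding Lq_norm_def using q by (intro powr_mono2 integral_nonneg_AE) auto
  also have "\<dots> = ((2 powr (q / 2) * (1 - c)) powr (1 / q)) ^ k"
    using c by (simp add: powr_power powr_realpow[symmetric] powr_powr mult_ac)
  also have "(2 powr (q / 2) * (1 - c)) powr (1 / q) = sqrt 2 * (1 - c) powr (1 / q)"
    using c q by (simp add: powr_mult powr_powr powr_half_sqrt)
  finally show "Lq_norm d q (cube_fun d k e S) \<le> (sqrt 2 * (1 - (2 - q) / 24) powr (1 / q)) ^ k"
    by (simp add: c_def)
qed

text \<open>At almost every point the monomials are unimodular up to the common phase, so
  \<open>subset_sum_powr_ge\<close> applies pointwise to the \<open>2 ^ k\<close> vertices;
  integration follows.\<close>

lemma riesz_proj_cube_fun_moments:
  assumes p: "0 < p" "p \<le> 2"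
  shows "2 ^ 2 ^ k * ((sqrt 2 ^ k) powr p / 24)
       \<le> (\<Sum>S\<in>Pow (Pow {..<k}). \<integral>z. norm (riesz_proj d (cube_fun d k e S) z) powr p \<partial>torus d)"
proof -
  interpret prob_space "torus d" by (rule prob_space_torus)
  have norm_eq: "norm (\<Sum>X\<in>S. \<Prod>j<d. z j ^ nat (cube_exp k e S X j)) = norm (\<Sum>X\<in>S. \<Prod>i\<in>X. z i * twist z i)"
    if "\<forall>j<d. norm (z j) = 1" "S \<subseteq> Pow {..<k}" for S z
  proof -
    have "(\<Sum>X\<in>S. \<Prod>j<d. z j ^ nat (cube_exp k e S X j)) = (\<Sum>X\<in>S. phase S z * (\<Prod>i\<in>X. z i * twist z i))"
    proof (rule sum.cong[OF refl])
      fix X assume X: "X \<in> S"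
      have "X \<subseteq> {..<k}" using X that by auto
      moreover have "0 \<le> cube_exp k e S X j" if "j < d" for j
        using cube_exp_nonneg_iff[of X S] calculation X that by auto
      ultimately show "(\<Prod>j<d. z j ^ nat (cube_exp k e S X j)) = phase S z * (\<Prod>i\<in>X. z i * twist z i)"
        using cube_monomial_eq[of z X S] that by (simp add: power_int_def)
    qed
    thus ?thesis using norm_phase[OF that(1)] by (simp add: sum_distrib_left[symmetric] norm_mult)
  qed
  have int: "integrable (torus d) (\<lambda>z. norm (\<Sum>X\<in>S. \<Prod>j<d. z j ^ nat (cube_exp k e S X j)) powr p)" for S
    using p by (intro polynomial_powr_integrable) auto
  have "2 ^ 2 ^ k * ((sqrt 2 ^ k) powr p / 24) = (\<integral>z. 2 ^ 2 ^ k * ((sqrt 2 ^ k) powr p / 24) \<partial>torus d)"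
    by (simp add: prob_space)
  also have "\<dots> \<le> (\<integral>z. (\<Sum>S\<in>Pow (Pow {..<k}). norm (\<Sum>X\<in>S. \<Prod>j<d. z j ^ nat (cube_exp k e S X j)) powr p) \<partial>torus d)"
  proof (rule integral_mono_AE)
    show "AE z in torus d. 2 ^ 2 ^ k * ((sqrt 2 ^ k) powr p / 24)
        \<le> (\<Sum>S\<in>Pow (Pow {..<k}). norm (\<Sum>X\<in>S. \<Prod>j<d. z j ^ nat (cube_exp k e S X j)) powr p)"
      using AE_torus[of d]
    proof eventually_elim
      case (elim z)
      have "norm (\<Prod>i\<in>X. z i * twist z i) = 1" if "X \<subseteq> {..<k}" for X
      proof -
        have "norm (z i * twist z i) = 1" if "i \<in> X" for i
          using that \<open>X \<subseteq> {..<k}\<close> elim d by (auto simp: norm_mult norm_twist)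
        thus ?thesis by (simp add: prod_norm[symmetric])
      qed
      hence "2 ^ card (Pow {..<k}) * (sqrt (card (Pow {..<k})) powr p / 24)
          \<le> (\<Sum>S\<in>Pow (Pow {..<k}). norm (\<Sum>X\<in>S. \<Prod>i\<in>X. z i * twist z i) powr p)"
        using p by (intro subset_sum_powr_ge) auto
      also have "\<dots> = (\<Sum>S\<in>Pow (Pow {..<k}). norm (\<Sum>X\<in>S. \<Prod>j<d. z j ^ nat (cube_exp k e S X j)) powr p)"
        using elim by (intro sum.cong refl) (simp add: norm_eq)
      finally show ?case by (simp add: card_Pow real_sqrt_power)
    qed
  qed (use int in auto)
  also have "\<dots> = (\<Sum>S\<in>Pow (Pow {..<k}). \<integral>z. norm (\<Sum>X\<in>S. \<Prod>j<d. z j ^ nat (cube_exp k e S X j)) powr p \<partial>torus d)"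
    using int by (intro Bochner_Integration.integral_sum) auto
  also have "\<dots> = (\<Sum>S\<in>Pow (Pow {..<k}). \<integral>z. norm (riesz_proj d (cube_fun d k e S) z) powr p \<partial>torus d)"
    by (intro sum.cong refl) (simp add: riesz_proj_cube_fun)
  finally show ?thesis .
qed

text \<open>Contractivity bounds the moment for every \<open>S\<close>, and summing over all
  \<open>S\<close> meets the Khinchine lower bound. The factors \<open>2 ^ 2 ^ k\<close> and
  \<open>(sqrt 2 ^ k) powr p\<close> cancel, leaving a quantity that decays in
  \<open>k\<close>.\<close>

lemma good_exps_imp_le:
  assumes q: "1 \<le> q" "q < 2" and p: "0 < p" "p \<le> 2" and good: "p' \<in> good_exps d q" "p \<le> p'"
  shows "1 / 24 \<le> ((1 - (2 - q) / 24) powr (p / q)) ^ k"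
proof -
  interpret prob_space "torus d" by (rule prob_space_torus)
  define r where "r = (1 - (2 - q) / 24) powr (1 / q)"
  define B where "B = (sqrt 2 * r) ^ k"
  have r: "0 < r" using q by (simp add: r_def)
  hence B: "0 < B" by (simp add: B_def)
  have le: "(\<integral>z. norm (riesz_proj d (cube_fun d k e S) z) powr p \<partial>torus d) \<le> B powr p"
    if "S \<subseteq> Pow {..<k}" for S
  proof -
    have "H_norm d p' (riesz_proj d (cube_fun d k e S)) \<le> ereal (Lq_norm d q (cube_fun d k e S))"
      using good(1) cube_fun_Lq(1)[OF q] unfolding good_exps_def by auto
    also have "\<dots> \<le> ereal B"
      using cube_fun_Lq(2)[OF q] by (simp add: B_def r_def)
    \<comment> \<open>Since \<open>p'\<close> is positive, \<open>H_norm\<close> is the radial norm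
      here and not the geometric mean.\<close>
    finally have "Hp_radial_norm d p' (riesz_proj d (cube_fun d k e S)) \<le> ereal B"
      using p good by (simp add: H_norm_def)
    hence "(\<integral>z. norm (riesz_proj d (cube_fun d k e S) z) powr p' \<partial>torus d) \<le> B powr p'"
      unfolding riesz_proj_cube_fun[OF that] using p good B
      by (intro polynomial_moment_le_of_Hp_radial_norm_le) auto
    \<comment> \<open>The good exponent \<open>p'\<close> may exceed 2, so the bound is lowered to
      \<open>p\<close>, where Khinchine applies.\<close>
    thus ?thesis
      unfolding riesz_proj_cube_fun[OF that] using p good B
      by (intro powr_moment_mono[of p p'] polynomial_powr_integrable) auto
  qed
  have "2 ^ 2 ^ k * ((sqrt 2 ^ k) powr p / 24) \<le> (\<Sum>S\<in>Pow (Pow {..<k}). B powr p)"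
    using le by (intro order_trans[OF riesz_proj_cube_fun_moments[OF p]] sum_mono) auto
  also have "\<dots> = 2 ^ 2 ^ k * B powr p"
    by (simp add: card_Pow)
  also have "B powr p = (sqrt 2 ^ k) powr p * (r ^ k) powr p"
    using r by (simp add: B_def power_mult_distrib powr_mult)
  finally have "1 / 24 \<le> (r ^ k) powr p"
    by (simp add: field_simps)
  also have "(r ^ k) powr p = (r powr p) ^ k"
    using r by (simp add: powr_realpow[symmetric] powr_powr mult_ac)
  also have "r powr p = (1 - (2 - q) / 24) powr (p / q)"
    by (simp add: r_def powr_powr)
  finally show ?thesis .
qed

end

theorem theorem12:
  fixes q :: real
  assumes "1 \<le> q" and "q < 2"
  shows "limsup (\<lambda>d. crit_exp d q) \<le> 0"
proof (rule ereal_le_epsilon2)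
  fix \<epsilon> :: real assume \<epsilon>: "0 < \<epsilon>"
  \<comment> \<open>The cap at 2 is the range of the Khinchine bound; any exponent above
    \<open>\<epsilon>\<close> is still at least \<open>p\<close>.\<close>
  define p where "p = min \<epsilon> 2"
  have p: "0 < p" "p \<le> 2" "p \<le> \<epsilon>" using \<epsilon> by (auto simp: p_def)
  define \<rho> where "\<rho> = (1 - (2 - q) / 24) powr (p / q)"
  have "0 \<le> \<rho>" "\<rho> < 1"
    using assms p powr_less_mono2[of "p / q" "1 - (2 - q) / 24" 1] by (auto simp: \<rho>_def)
  hence "(\<lambda>k. \<rho> ^ k) \<longlonglongrightarrow> 0" by (intro LIMSEQ_power_zero) auto
  hence "\<forall>\<^sub>F k in sequentially. \<rho> ^ k < 1 / 24" by (rule order_tendstoD) simp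
  then obtain k where k: "\<rho> ^ k < 1 / 24" by (auto simp: eventually_sequentially)
  have "card (Pow {..<k}) = card {k..<k + 2 ^ k}" by (simp add: card_Pow)
  then obtain e where e: "bij_betw e {k..<k + 2 ^ k} (Pow {..<k})"
    by (metis finite_same_card_bij finite_atLeastLessThan finite_Pow_iff finite_lessThan)
  have "crit_exp d q \<le> ereal \<epsilon>" if "k + 2 ^ k \<le> d" for d
  proof -
    have "p' \<le> \<epsilon>" if "p' \<in> good_exps d q" for p'
      using good_exps_imp_le[OF e \<open>k + 2 ^ k \<le> d\<close> assms p(1,2) that] k p(3) by (force simp: \<rho>_def)
    \<comment> \<open>Covers the default value of \<open>crit_exp\<close> when there is no good
      exponent.\<close>
    moreover have "-1 \<le> ereal \<epsilon>" using \<epsilon> by (simp add: one_ereal_def)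
    ultimately show ?thesis unfolding crit_exp_def by (auto intro!: Sup_least)
  qed
  hence "\<forall>\<^sub>F d in sequentially. crit_exp d q \<le> ereal \<epsilon>"
    by (auto simp: eventually_sequentially)
  thus "limsup (\<lambda>d. crit_exp d q) \<le> 0 + ereal \<epsilon>"
    by (simp add: Limsup_bounded)
qed

end
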